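(* Let $(J_1,\mathcal{B}_1)$ and $(J_2,\mathcal{B}_2)$ be set algebras with product $(J,\mathcal{B})$, and let $\varphi_1\colon\mathcal{B}_1\to\mathbb{R}_+$, $\varphi_2\colon\mathcal{B}_2\to\mathbb{R}_+$ be submodular with $\varphi_1(\emptyset)=\varphi_2(\emptyset)=0$. Let $\alpha_1\colon\mathcal{B}_1\to\mathbb{R}_+$ and $\alpha_2\colon\mathcal{B}_2\to\mathbb{R}_+$ be nonnegative charges with $\alpha_1(J_1)=\varphi_1(J_1)$ and $\alpha_2(J_2)=\varphi_2(J_2)$. Define $b\colon\mathcal{B}\to\mathbb{R}$ by \[ b(Z)=\hat\alpha_1\bigl(x\mapsto\varphi_2(Z_{(x)})\bigr)+\hat\alpha_2\bigl(y\mapsto\varphi_1(Z^{(y)})\bigr)-\hat\alpha_1\bigl(x\mapsto\alpha_2(Z_{(x)})\bigr).\] Then $b$ is a submodular coupling of $\varphi_1$ and $\varphi_2$.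
   Context: A set algebra $(J,\mathcal{B})$ is a family $\mathcal{B}$ of subsets of $J$ containing $\emptyset$ and closed under complements and finite unions. The product algebra $\mathcal{B}=\mathcal{B}_1\otimes\mathcal{B}_2$ on $J=J_1\times J_2$ is the algebra generated by $\{X_1\times J_2: X_1\in\mathcal{B}_1\}\cup\{J_1\times X_2:X_2\in\mathcal{B}_2\}$. A charge is a finitely additive set function. For $Z\in\mathcal{B}$, $x\in J_1$, $y\in J_2$ let $Z_{(x)}=\{y'\in J_2:(x,y')\in Z\}\in\mathcal{B}_2$ and $Z^{(y)}=\{x'\in J_1:(x',y)\in Z\}\in\mathcal{B}_1$; the functions $x\mapsto\varphi_2(Z_{(x)})$, $x\mapsto\alpha_2(Z_{(x)})$, $y\mapsto\varphi_1(Z^{(y)})$ take finitely many values and are measurable (preimages lie in the respective algebras). For a nonnegative charge $\alpha$ on $(J,\mathcal{B})$ and a nonnegative bounded measurable $f$, $\hat\alpha(f)=\int_0^\infty\alpha(\{f\ge t\})\,dt$. Submodularity on an algebra: $\varphi(X)+\varphi(Y)\ge\varphi(X\cap Y)+\varphi(X\cup Y)$ for all $X,Y$ in the algebra. $\varphi\colon\mathcal{B}\to\mathbb{R}$ is a coupling of $\varphi_1,\varphi_2$ if $\varphi(X_1\times J_2)=\varphi_1(X_1)\varphi_2(J_2)$ for all $X_1\in\mathcal{B}_1$ and $\varphi(J_1\times X_2)=\varphi_1(J_1)\varphi_2(X_2)$ for all $X_2\in\mathcal{B}_2$. *)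

theory Defs
  imports "HOL-Analysis.Analysis"
begin

text \<open>
  A set algebra on \<open>J\<close> is \<^const>\<open>algebra\<close>, and a charge on \<open>B\<close> is a real-valued set
  function that is \<^const>\<open>additive\<close> on \<open>B\<close>. Set functions are total in HOL, so every
  property below is relativised to the algebra on which the function lives.
\<close>

definition product_algebra ::
    "'a set \<Rightarrow> 'a set set \<Rightarrow> 'b set \<Rightarrow> 'b set set \<Rightarrow> ('a \<times> 'b) set set" where
  "product_algebra J1 B1 J2 B2 =
     algebra (J1 \<times> J2) hull ({X1 \<times> J2 | X1. X1 \<in> B1} \<union> {J1 \<times> X2 | X2. X2 \<in> B2})"

definition submodular_on :: "'a set set \<Rightarrow> ('a set \<Rightarrow> real) \<Rightarrow> bool" where
  "submodular_on B \<phi> \<longleftrightarrow> (\<forall>X\<in>B. \<forall>Y\<in>B. \<phi> X + \<phi> Y \<ge> \<phi> (X \<inter> Y) + \<phi> (X \<union> Y))"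

text \<open>
  The integral \<open>\<integral>\<^sub>0\<^sup>\<infinity> \<alpha> {f \<ge> t} dt\<close>. For a nonnegative charge \<open>\<alpha>\<close> and a nonnegative bounded
  measurable \<open>f\<close> the integrand is antimono in \<open>t\<close> and vanishes for large \<open>t\<close>, so
  the Henstock-Kurzweil, Lebesgue and improper Riemann readings coincide.
\<close>

definition charge_integral :: "'a set \<Rightarrow> ('a set \<Rightarrow> real) \<Rightarrow> ('a \<Rightarrow> real) \<Rightarrow> real" where
  "charge_integral J \<alpha> f = integral {0..} (\<lambda>t. \<alpha> {x \<in> J. f x \<ge> t})"

definition section1 :: "'b set \<Rightarrow> ('a \<times> 'b) set \<Rightarrow> 'a \<Rightarrow> 'b set" where
  "section1 J2 Z x = {y \<in> J2. (x, y) \<in> Z}"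

definition section2 :: "'a set \<Rightarrow> ('a \<times> 'b) set \<Rightarrow> 'b \<Rightarrow> 'a set" where
  "section2 J1 Z y = {x \<in> J1. (x, y) \<in> Z}"

definition coupling ::
    "'a set \<Rightarrow> 'a set set \<Rightarrow> 'b set \<Rightarrow> 'b set set \<Rightarrow>
     ('a set \<Rightarrow> real) \<Rightarrow> ('b set \<Rightarrow> real) \<Rightarrow> (('a \<times> 'b) set \<Rightarrow> real) \<Rightarrow> bool" where
  "coupling J1 B1 J2 B2 \<phi>1 \<phi>2 \<phi> \<longleftrightarrow>
     (\<forall>X1\<in>B1. \<phi> (X1 \<times> J2) = \<phi>1 X1 * \<phi>2 J2) \<and>
     (\<forall>X2\<in>B2. \<phi> (J1 \<times> X2) = \<phi>1 J1 * \<phi>2 X2)"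

end

theory Submission
  imports Defs
begin

text \<open>
  On functions of finite range the charge integral is a finite sum over fibres, hence monotone and
  additive. Sections commute with unions, intersections and complements, so the first two terms of
  \<open>b\<close> are integrals of submodular expressions, while the third is modular because \<open>\<alpha>2\<close> is. On a
  cylinder over \<open>B1\<close> the first and third terms cancel; on a cylinder over \<open>B2\<close> the second and
  third do.
\<close>

section \<open>Functions of finite range with fibres in an algebra\<close>

text \<open>The codomain is arbitrary so that set-valued section maps qualify. Only single fibres
  are required to lie in \<open>B\<close>, because no structure on the codomain is
  available.\<close>

definition simple_on :: "'a set \<Rightarrow> 'a set set \<Rightarrow> ('a \<Rightarrow> 'c) \<Rightarrow> bool" where
  "simple_on J B F \<longleftrightarrow> finite (F ` J) \<and> (\<forall>c. F -` {c} \<inter> J \<in> B)"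

text \<open>Only finitely many values lie in \<open>S\<close>, so the preimage is a finite union of
  fibres, whatever \<open>S\<close> is. This makes \<open>simple_on\<close> stable under composition
  with any function, in particular with any set function.\<close>

lemma simple_on_vimage:
  assumes "algebra J B" "simple_on J B F"
  shows "F -` S \<inter> J \<in> B"
proof -
  interpret algebra J B by fact
  have "F -` S \<inter> J = (\<Union>c\<in>F ` J \<inter> S. F -` {c} \<inter> J)"
    by auto
  also have "\<dots> \<in> B"
    using assms(2) by (intro finite_UN) (auto simp: simple_on_def)
  finally show ?thesis .
qed

lemma simple_on_compose:
  assumes "algebra J B" "simple_on J B F"
  shows "simple_on J B (\<lambda>x. g (F x))"
proof -
  have "(\<lambda>x. g (F x)) -` {c} \<inter> J \<in> B" for c
    using simple_on_vimage[OF assms, of "g -` {c}"] by (simp add: vimage_def)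
  moreover have "finite ((\<lambda>x. g (F x)) ` J)"
    using assms(2) by (simp add: simple_on_def flip: image_image)
  ultimately show ?thesis
    by (simp add: simple_on_def)
qed

text \<open>The fibres of the pair form the common refinement of two finite partitions. Through it,
  two functions can be treated as functions of one.\<close>

lemma simple_on_Pair:
  assumes "algebra J B" "simple_on J B F" "simple_on J B G"
  shows "simple_on J B (\<lambda>x. (F x, G x))"
proof -
  interpret algebra J B by fact
  have "(\<lambda>x. (F x, G x)) -` {(c, d)} \<inter> J = (F -` {c} \<inter> J) \<inter> (G -` {d} \<inter> J)" for c d
    by auto
  then have "(\<lambda>x. (F x, G x)) -` {p} \<inter> J \<in> B" for p
    using assms(2,3) by (cases p) (auto simp: simple_on_def)
  moreover have "finite ((\<lambda>x. (F x, G x)) ` J)"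
    by (rule finite_subset[of _ "F ` J \<times> G ` J"]) (use assms in \<open>auto simp: simple_on_def\<close>)
  ultimately show ?thesis
    by (simp add: simple_on_def)
qed

lemma simple_on_cong:
  assumes "simple_on J B F" "\<And>x. x \<in> J \<Longrightarrow> F x = G x"
  shows "simple_on J B G"
proof -
  have "F ` J = G ` J" "F -` {c} \<inter> J = G -` {c} \<inter> J" for c
    using assms(2) by auto
  then show ?thesis
    using assms(1) by (simp add: simple_on_def)
qed

lemma simple_on_const:
  assumes "algebra J B"
  shows "simple_on J B (\<lambda>x. c)"
proof -
  interpret algebra J B by fact
  have "(\<lambda>x. c) -` {d} \<inter> J = (if c = d then J else {})" for d
    by auto
  moreover have "finite ((\<lambda>x. c) ` J)"
    by (rule finite_subset[of _ "{c}"]) auto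
  ultimately show ?thesis
    by (simp add: simple_on_def)
qed

lemma simple_on_mem:
  assumes "algebra J B" "A \<in> B"
  shows "simple_on J B (\<lambda>x. x \<in> A)"
proof -
  interpret algebra J B by fact
  have "(\<lambda>x. x \<in> A) -` {c} \<inter> J = (if c then A else J - A)" for c
    using assms(2) sets_into_space by auto
  then show ?thesis
    using assms(2) by (auto simp: simple_on_def intro: finite_subset[of _ UNIV])
qed

section \<open>Finite additivity of charges\<close>

text \<open>\<open>additive\<close> does not postulate the value at the empty set; it follows
  because the empty set is disjoint from itself.\<close>

lemma additive_empty:
  fixes \<alpha> :: "'a set \<Rightarrow> real"
  assumes "{} \<in> B" "additive B \<alpha>"
  shows "\<alpha> {} = 0"
  using additiveD[OF assms(2), of "{}" "{}"] assms(1) by simp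

lemma additive_finite_Union:
  fixes \<alpha> :: "'a set \<Rightarrow> real"
  assumes "algebra J B" "additive B \<alpha>" "finite I" "disjoint_family_on A I"
    and "\<And>i. i \<in> I \<Longrightarrow> A i \<in> B"
  shows "\<alpha> (\<Union>i\<in>I. A i) = (\<Sum>i\<in>I. \<alpha> (A i))"
proof -
  interpret algebra J B by fact
  show ?thesis
    using assms(3-5)
  proof (induction I rule: finite_induct)
    case empty
    then show ?case
      using additive_empty[OF _ assms(2)] by simp
  next
    case (insert i I)
    have "A i \<inter> (\<Union>j\<in>I. A j) = {}" "disjoint_family_on A I"
      using insert.prems(1) insert.hyps(2) by (auto simp: disjoint_family_on_def)
    moreover have "(\<Union>j\<in>I. A j) \<in> B"
      using insert.prems(2) insert.hyps(1) by (intro finite_UN) auto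
    ultimately show ?case
      using insert additiveD[OF assms(2), of "A i" "\<Union>j\<in>I. A j"] by simp
  qed
qed

section \<open>The charge integral on functions of finite range\<close>

text \<open>One layer of the layer-cake formula: a fibre of charge \<open>c\<close> on which the
  integrand has value \<open>v\<close> belongs to the level set exactly for \<open>t\<close> up to
  \<open>v\<close>.\<close>

lemma has_integral_cutoff:
  fixes c v :: real
  assumes "0 \<le> v"
  shows "((\<lambda>t. if t \<le> v then c else 0) has_integral v * c) {0..}"
proof -
  have "((\<lambda>t. c) has_integral v * c) {0..v}"
    using has_integral_const_real[of c 0 v] assms by simp
  then have "((\<lambda>t. if t \<in> {0..v} then c else 0) has_integral v * c) {0..}"
    by (subst has_integral_restrict) auto
  then show ?thesis
    by (rule has_integral_eq[rotated]) auto
qed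

text \<open>Each level set is the disjoint union of the fibres of \<open>F\<close> whose value under
  \<open>g\<close> reaches \<open>t\<close>, so the integrand in \<open>t\<close> is a finite sum of
  cutoffs. Separating the partition map \<open>F\<close> from the real values \<open>g\<close> lets
  several integrands share the same fibre sum, which makes additivity and monotonicity
  termwise.\<close>

lemma charge_integral_simple:
  assumes alg: "algebra J B" and add: "additive B \<alpha>" and F: "simple_on J B F"
    and nonneg: "\<And>x. x \<in> J \<Longrightarrow> 0 \<le> g (F x)"
  shows "charge_integral J \<alpha> (\<lambda>x. g (F x)) = (\<Sum>c\<in>F ` J. g c * \<alpha> (F -` {c} \<inter> J))"
proof -
  have fin: "finite (F ` J)"
    using F by (simp add: simple_on_def)
  have level: "\<alpha> {x \<in> J. t \<le> g (F x)} = (\<Sum>c\<in>F ` J. if t \<le> g c then \<alpha> (F -` {c} \<inter> J) else 0)" for t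
  proof -
    have "{x \<in> J. t \<le> g (F x)} = (\<Union>c\<in>{c \<in> F ` J. t \<le> g c}. F -` {c} \<inter> J)"
      by auto
    also have "\<alpha> \<dots> = (\<Sum>c\<in>{c \<in> F ` J. t \<le> g c}. \<alpha> (F -` {c} \<inter> J))"
      using fin F by (intro additive_finite_Union[OF alg add])
        (auto simp: disjoint_family_on_def simple_on_def)
    also have "\<dots> = (\<Sum>c\<in>F ` J. if t \<le> g c then \<alpha> (F -` {c} \<inter> J) else 0)"
      using fin by (rule sum.inter_filter)
    finally show ?thesis .
  qed
  have "((\<lambda>t. \<Sum>c\<in>F ` J. if t \<le> g c then \<alpha> (F -` {c} \<inter> J) else 0)
      has_integral (\<Sum>c\<in>F ` J. g c * \<alpha> (F -` {c} \<inter> J))) {0..}"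
    using fin nonneg by (intro has_integral_sum has_integral_cutoff) auto
  then show ?thesis
    unfolding charge_integral_def level by (rule integral_unique)
qed

lemma charge_integral_add:
  assumes "algebra J B" "additive B \<alpha>" "simple_on J B F"
    and "\<And>x. x \<in> J \<Longrightarrow> 0 \<le> g (F x)" "\<And>x. x \<in> J \<Longrightarrow> 0 \<le> h (F x)"
  shows "charge_integral J \<alpha> (\<lambda>x. g (F x) + h (F x)) =
    charge_integral J \<alpha> (\<lambda>x. g (F x)) + charge_integral J \<alpha> (\<lambda>x. h (F x))"
  using charge_integral_simple[OF assms(1-3), of g] charge_integral_simple[OF assms(1-3), of h]
    charge_integral_simple[OF assms(1-3), of "\<lambda>c. g c + h c"] assms(4,5)
  by (simp add: distrib_right sum.distrib)

lemma charge_integral_mono: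
  assumes "algebra J B" "additive B \<alpha>" "\<And>X. X \<in> B \<Longrightarrow> 0 \<le> \<alpha> X" "simple_on J B F"
    and "\<And>x. x \<in> J \<Longrightarrow> 0 \<le> g (F x)" "\<And>x. x \<in> J \<Longrightarrow> g (F x) \<le> h (F x)"
  shows "charge_integral J \<alpha> (\<lambda>x. g (F x)) \<le> charge_integral J \<alpha> (\<lambda>x. h (F x))"
proof -
  have "0 \<le> h (F x)" if "x \<in> J" for x
    using assms(5,6)[OF that] by simp
  moreover have "(\<Sum>c\<in>F ` J. g c * \<alpha> (F -` {c} \<inter> J)) \<le> (\<Sum>c\<in>F ` J. h c * \<alpha> (F -` {c} \<inter> J))"
    using assms(3,4,6) by (intro sum_mono mult_right_mono) (auto simp: simple_on_def)
  ultimately show ?thesis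
    using assms charge_integral_simple[OF assms(1,2,4), of g]
      charge_integral_simple[OF assms(1,2,4), of h] by simp
qed

lemma charge_integral_cong:
  assumes "\<And>x. x \<in> J \<Longrightarrow> f x = g x"
  shows "charge_integral J \<alpha> f = charge_integral J \<alpha> g"
proof -
  have "{x \<in> J. t \<le> f x} = {x \<in> J. t \<le> g x}" for t
    using assms by auto
  then show ?thesis
    by (simp add: charge_integral_def)
qed

lemma charge_integral_indicator:
  assumes alg: "algebra J B" and add: "additive B \<alpha>" and A: "A \<in> B" and "0 \<le> v"
  shows "charge_integral J \<alpha> (\<lambda>x. if x \<in> A then v else 0) = v * \<alpha> A"
proof -
  interpret algebra J B by fact
  have AJ: "(\<lambda>x. x \<in> A) -` {True} \<inter> J = A"
    using sets_into_space[OF A] by auto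
  have "charge_integral J \<alpha> (\<lambda>x. if x \<in> A then v else 0) =
      (\<Sum>c\<in>(\<lambda>x. x \<in> A) ` J. (if c then v else 0) * \<alpha> ((\<lambda>x. x \<in> A) -` {c} \<inter> J))"
    using \<open>0 \<le> v\<close> by (intro charge_integral_simple[OF alg add simple_on_mem[OF alg A]]) auto
  \<comment> \<open>If \<open>A\<close> is empty or all of \<open>J\<close>, the membership map
    misses a truth value. The fibre over a missed value is empty and has charge zero, so summing
    over both truth values changes nothing.\<close>
  also have "\<dots> = (\<Sum>c\<in>UNIV. (if c then v else 0) * \<alpha> ((\<lambda>x. x \<in> A) -` {c} \<inter> J))"
  proof (rule sum.mono_neutral_left)
    have "\<alpha> {} = 0"
      using add by (intro additive_empty) auto
    moreover have "(\<lambda>x. x \<in> A) -` {c} \<inter> J = {}" if "c \<notin> (\<lambda>x. x \<in> A) ` J" for c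
      using that by auto
    ultimately show "\<forall>c\<in>UNIV - (\<lambda>x. x \<in> A) ` J.
        (if c then v else 0) * \<alpha> ((\<lambda>x. x \<in> A) -` {c} \<inter> J) = 0"
      by simp
  qed auto
  also have "\<dots> = v * \<alpha> A"
    unfolding UNIV_bool using AJ by simp
  finally show ?thesis .
qed

lemma charge_integral_const:
  assumes "algebra J B" "additive B \<alpha>" "0 \<le> v"
  shows "charge_integral J \<alpha> (\<lambda>x. v) = v * \<alpha> J"
proof -
  have "J \<in> B"
    using assms(1) by (rule algebra.top)
  have "charge_integral J \<alpha> (\<lambda>x. v) = charge_integral J \<alpha> (\<lambda>x. if x \<in> J then v else 0)"
    by (rule charge_integral_cong) simp
  with charge_integral_indicator[OF assms(1,2) \<open>J \<in> B\<close> assms(3)] show ?thesis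
    by simp
qed

section \<open>Integrating submodular and modular set functions\<close>

text \<open>The submodular inequality for \<open>F x\<close> and \<open>G x\<close> holds at each
  point, and integration against a nonnegative charge preserves it.\<close>

lemma charge_integral_submodular:
  assumes alg: "algebra J B" "algebra K C" and add: "additive B \<alpha>"
    and nonneg: "\<And>X. X \<in> B \<Longrightarrow> 0 \<le> \<alpha> X" "\<And>X. X \<in> C \<Longrightarrow> 0 \<le> \<phi> X"
    and sub: "submodular_on C \<phi>"
    and F: "simple_on J B F" "F \<in> J \<rightarrow> C" and G: "simple_on J B G" "G \<in> J \<rightarrow> C"
  shows "charge_integral J \<alpha> (\<lambda>x. \<phi> (F x \<inter> G x)) + charge_integral J \<alpha> (\<lambda>x. \<phi> (F x \<union> G x))
    \<le> charge_integral J \<alpha> (\<lambda>x. \<phi> (F x)) + charge_integral J \<alpha> (\<lambda>x. \<phi> (G x))"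
proof -
  interpret K: algebra K C by fact
  \<comment> \<open>All four integrands become functions of the single map \<open>P\<close>, as
    additivity and monotonicity of the integral require.\<close>
  define P where "P x = (F x, G x)" for x
  have P: "simple_on J B P"
    unfolding P_def by (rule simple_on_Pair[OF alg(1) F(1) G(1)])
  define f g h k where "f p = \<phi> (fst p \<inter> snd p)" and "g p = \<phi> (fst p \<union> snd p)"
    and "h p = \<phi> (fst p)" and "k p = \<phi> (snd p)" for p
  note defs = f_def g_def h_def k_def P_def
  have ge0: "0 \<le> f (P x)" "0 \<le> g (P x)" "0 \<le> h (P x)" "0 \<le> k (P x)" if "x \<in> J" for x
    using that F(2) G(2) by (auto simp: defs intro!: nonneg)
  have "charge_integral J \<alpha> (\<lambda>x. f (P x)) + charge_integral J \<alpha> (\<lambda>x. g (P x)) =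
      charge_integral J \<alpha> (\<lambda>x. f (P x) + g (P x))"
    using ge0 by (intro charge_integral_add[OF alg(1) add P, symmetric])
  also have "\<dots> \<le> charge_integral J \<alpha> (\<lambda>x. h (P x) + k (P x))"
  proof (rule charge_integral_mono[OF alg(1) add nonneg(1) P])
    show "0 \<le> f (P x) + g (P x)" if "x \<in> J" for x
      using ge0[OF that] by simp
    show "f (P x) + g (P x) \<le> h (P x) + k (P x)" if "x \<in> J" for x
      using that F(2) G(2) sub by (auto simp: defs submodular_on_def)
  qed
  also have "\<dots> = charge_integral J \<alpha> (\<lambda>x. h (P x)) + charge_integral J \<alpha> (\<lambda>x. k (P x))"
    using ge0 by (intro charge_integral_add[OF alg(1) add P])
  finally show ?thesis
    by (simp add: defs)
qed

text \<open>The analogue with equality at each point. Equality matters because this term enters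
  \<open>b\<close> with a minus sign.\<close>

lemma charge_integral_modular:
  assumes alg: "algebra J B" "algebra K C" and add: "additive B \<alpha>" "additive C \<beta>"
    and nonneg: "\<And>X. X \<in> C \<Longrightarrow> 0 \<le> \<beta> X"
    and F: "simple_on J B F" "F \<in> J \<rightarrow> C" and G: "simple_on J B G" "G \<in> J \<rightarrow> C"
  shows "charge_integral J \<alpha> (\<lambda>x. \<beta> (F x \<inter> G x)) + charge_integral J \<alpha> (\<lambda>x. \<beta> (F x \<union> G x))
    = charge_integral J \<alpha> (\<lambda>x. \<beta> (F x)) + charge_integral J \<alpha> (\<lambda>x. \<beta> (G x))"
proof -
  interpret K: algebra K C by fact
  \<comment> \<open>Splitting \<open>Y - X\<close> off both \<open>X \<union> Y\<close> and
    \<open>Y\<close> shows that a charge is modular.\<close>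
  have modular: "\<beta> (X \<inter> Y) + \<beta> (X \<union> Y) = \<beta> X + \<beta> Y" if "X \<in> C" "Y \<in> C" for X Y
  proof -
    have "\<beta> (X \<union> (Y - X)) = \<beta> X + \<beta> (Y - X)"
      using that by (intro additiveD[OF add(2)]) auto
    moreover have "\<beta> ((X \<inter> Y) \<union> (Y - X)) = \<beta> (X \<inter> Y) + \<beta> (Y - X)"
      using that by (intro additiveD[OF add(2)]) auto
    moreover have "X \<union> (Y - X) = X \<union> Y" "(X \<inter> Y) \<union> (Y - X) = Y"
      by auto
    ultimately show ?thesis
      by simp
  qed
  define P where "P x = (F x, G x)" for x
  have P: "simple_on J B P"
    unfolding P_def by (rule simple_on_Pair[OF alg(1) F(1) G(1)])
  define f g h k where "f p = \<beta> (fst p \<inter> snd p)" and "g p = \<beta> (fst p \<union> snd p)"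
    and "h p = \<beta> (fst p)" and "k p = \<beta> (snd p)" for p
  note defs = f_def g_def h_def k_def P_def
  have ge0: "0 \<le> f (P x)" "0 \<le> g (P x)" "0 \<le> h (P x)" "0 \<le> k (P x)" if "x \<in> J" for x
    using that F(2) G(2) by (auto simp: defs intro!: nonneg)
  have "charge_integral J \<alpha> (\<lambda>x. f (P x)) + charge_integral J \<alpha> (\<lambda>x. g (P x)) =
      charge_integral J \<alpha> (\<lambda>x. f (P x) + g (P x))"
    using ge0 by (intro charge_integral_add[OF alg(1) add(1) P, symmetric])
  also have "\<dots> = charge_integral J \<alpha> (\<lambda>x. h (P x) + k (P x))"
    using F(2) G(2) modular by (intro charge_integral_cong) (auto simp: defs)
  also have "\<dots> = charge_integral J \<alpha> (\<lambda>x. h (P x)) + charge_integral J \<alpha> (\<lambda>x. k (P x))"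
    using ge0 by (intro charge_integral_add[OF alg(1) add(1) P])
  finally show ?thesis
    by (simp add: defs)
qed

section \<open>Closure properties of the product algebra\<close>

text \<open>The hull is the intersection of all algebras containing the cylinders, and each of these
  is closed under binary intersections.\<close>

lemma product_algebra_Int:
  assumes "Z \<in> product_algebra J1 B1 J2 B2" "W \<in> product_algebra J1 B1 J2 B2"
  shows "Z \<inter> W \<in> product_algebra J1 B1 J2 B2"
  using assms unfolding product_algebra_def hull_def by (auto simp: algebra_iff_Int)

lemma product_algebra_Un:
  assumes "Z \<in> product_algebra J1 B1 J2 B2" "W \<in> product_algebra J1 B1 J2 B2"
  shows "Z \<union> W \<in> product_algebra J1 B1 J2 B2"
  using assms unfolding product_algebra_def hull_def by (auto simp: algebra_iff_Un)

lemma product_algebra_cylinder1: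
  "X \<in> B1 \<Longrightarrow> X \<times> J2 \<in> product_algebra J1 B1 J2 B2"
  unfolding product_algebra_def by (rule hull_inc) auto

lemma product_algebra_cylinder2:
  "X \<in> B2 \<Longrightarrow> J1 \<times> X \<in> product_algebra J1 B1 J2 B2"
  unfolding product_algebra_def by (rule hull_inc) auto

section \<open>Sections of sets in the product algebra\<close>

text \<open>Stated for an abstract section map \<open>S\<close>, so that it covers both coordinate directions.\<close>

lemma simple_on_section_hull:
  assumes alg: "algebra J B" "algebra K C" and Z: "Z \<in> algebra \<Omega> hull \<G>"
    and gen: "\<And>Z. Z \<in> \<G> \<Longrightarrow> Z \<subseteq> \<Omega> \<and> simple_on J B (S Z) \<and> S Z \<in> J \<rightarrow> C"
    and Un: "\<And>Z W x. S (Z \<union> W) x = S Z x \<union> S W x"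
    and empty: "\<And>x. S {} x = {}"
    and compl: "\<And>Z x. x \<in> J \<Longrightarrow> S (\<Omega> - Z) x = K - S Z x"
  shows "simple_on J B (S Z) \<and> S Z \<in> J \<rightarrow> C"
proof -
  interpret K: algebra K C by fact
  \<comment> \<open>The sets with well-behaved sections are shown to form an algebra containing the
    generators, hence the hull. The conjunct \<open>Z \<subseteq> \<Omega>\<close> is added because
    an algebra on \<open>\<Omega>\<close> may contain only subsets of
    \<open>\<Omega>\<close>.\<close>
  have "Z \<subseteq> \<Omega> \<and> simple_on J B (S Z) \<and> S Z \<in> J \<rightarrow> C"
    using Z
  proof (rule hull_induct)
    show "algebra \<Omega> {Z. Z \<subseteq> \<Omega> \<and> simple_on J B (S Z) \<and> S Z \<in> J \<rightarrow> C}"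
      unfolding algebra_iff_Un
    proof (intro conjI ballI)
      show "{} \<in> {Z. Z \<subseteq> \<Omega> \<and> simple_on J B (S Z) \<and> S Z \<in> J \<rightarrow> C}"
        using simple_on_cong[OF simple_on_const[OF alg(1)], of "{}" "S {}"] by (auto simp: empty)
    next
      fix Z assume Z: "Z \<in> {Z. Z \<subseteq> \<Omega> \<and> simple_on J B (S Z) \<and> S Z \<in> J \<rightarrow> C}"
      then have "simple_on J B (S (\<Omega> - Z))"
        using simple_on_cong[OF simple_on_compose[OF alg(1), of "S Z" "\<lambda>X. K - X"]]
        by (simp add: compl)
      with Z show "\<Omega> - Z \<in> {Z. Z \<subseteq> \<Omega> \<and> simple_on J B (S Z) \<and> S Z \<in> J \<rightarrow> C}"
        by (auto simp: compl Pi_iff)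
    next
      fix Z W
      assume ZW: "Z \<in> {Z. Z \<subseteq> \<Omega> \<and> simple_on J B (S Z) \<and> S Z \<in> J \<rightarrow> C}"
        "W \<in> {Z. Z \<subseteq> \<Omega> \<and> simple_on J B (S Z) \<and> S Z \<in> J \<rightarrow> C}"
      then have "simple_on J B (\<lambda>x. (S Z x, S W x))"
        using simple_on_Pair[OF alg(1)] by auto
      then have "simple_on J B (S (Z \<union> W))"
        by (rule simple_on_cong[OF simple_on_compose[OF alg(1), where g = "\<lambda>p. fst p \<union> snd p"]])
          (simp add: Un)
      with ZW show "Z \<union> W \<in> {Z. Z \<subseteq> \<Omega> \<and> simple_on J B (S Z) \<and> S Z \<in> J \<rightarrow> C}"
        by (auto simp: Un Pi_iff)
    qed auto
  qed (rule gen)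
  then show ?thesis
    by simp
qed

text \<open>In one direction the section of a cylinder is constant, in the other it depends only on
  membership in the base. The integrals over cylinders thereby reduce to
  \<open>charge_integral_const\<close> and \<open>charge_integral_indicator\<close>.\<close>

lemma section_cylinder:
  "x \<in> J1 \<Longrightarrow> section1 J2 (X1 \<times> J2) x = (if x \<in> X1 then J2 else {})"
  "x \<in> J1 \<Longrightarrow> X2 \<subseteq> J2 \<Longrightarrow> section1 J2 (J1 \<times> X2) x = X2"
  "y \<in> J2 \<Longrightarrow> X1 \<subseteq> J1 \<Longrightarrow> section2 J1 (X1 \<times> J2) y = X1"
  "y \<in> J2 \<Longrightarrow> section2 J1 (J1 \<times> X2) y = (if y \<in> X2 then J1 else {})"
  by (auto simp: section1_def section2_def)

lemma section_Int:
  "section1 J2 (Z \<inter> W) x = section1 J2 Z x \<inter> section1 J2 W x"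
  "section2 J1 (Z \<inter> W) y = section2 J1 Z y \<inter> section2 J1 W y"
  by (auto simp: section1_def section2_def)

lemma section_Un:
  "section1 J2 (Z \<union> W) x = section1 J2 Z x \<union> section1 J2 W x"
  "section2 J1 (Z \<union> W) y = section2 J1 Z y \<union> section2 J1 W y"
  by (auto simp: section1_def section2_def)

lemma section_empty: "section1 J2 {} x = {}" "section2 J1 {} y = {}"
  by (auto simp: section1_def section2_def)

lemma section_Diff:
  "x \<in> J1 \<Longrightarrow> section1 J2 (J1 \<times> J2 - Z) x = J2 - section1 J2 Z x"
  "y \<in> J2 \<Longrightarrow> section2 J1 (J1 \<times> J2 - Z) y = J1 - section2 J1 Z y"
  by (auto simp: section1_def section2_def)

text \<open>Finite range and measurability are proved for the set-valued map itself, so they pass to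
  its composition with both \<open>\<phi>2\<close> and \<open>\<alpha>2\<close>.\<close>

lemma simple_on_section1:
  assumes "algebra J1 B1" "algebra J2 B2" "Z \<in> product_algebra J1 B1 J2 B2"
  shows "simple_on J1 B1 (section1 J2 Z)" "section1 J2 Z \<in> J1 \<rightarrow> B2"
proof -
  interpret A1: algebra J1 B1 by fact
  interpret A2: algebra J2 B2 by fact
  have cyl1: "X \<times> J2 \<subseteq> J1 \<times> J2 \<and> simple_on J1 B1 (section1 J2 (X \<times> J2))
      \<and> section1 J2 (X \<times> J2) \<in> J1 \<rightarrow> B2" if "X \<in> B1" for X
    using that A1.sets_into_space[OF that]
      simple_on_cong[OF simple_on_compose[OF assms(1) simple_on_mem[OF assms(1) that],
        of "\<lambda>c. if c then J2 else {}"], of "section1 J2 (X \<times> J2)"]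
    by (auto simp: section_cylinder)
  have cyl2: "J1 \<times> X \<subseteq> J1 \<times> J2 \<and> simple_on J1 B1 (section1 J2 (J1 \<times> X))
      \<and> section1 J2 (J1 \<times> X) \<in> J1 \<rightarrow> B2" if "X \<in> B2" for X
    using that A2.sets_into_space[OF that]
      simple_on_cong[OF simple_on_const[OF assms(1)], of X "section1 J2 (J1 \<times> X)"]
    by (auto simp: section_cylinder)
  have "simple_on J1 B1 (section1 J2 Z) \<and> section1 J2 Z \<in> J1 \<rightarrow> B2"
    using assms(1,2) assms(3)[unfolded product_algebra_def]
  proof (rule simple_on_section_hull)
    fix Z assume "Z \<in> {X1 \<times> J2 |X1. X1 \<in> B1} \<union> {J1 \<times> X2 |X2. X2 \<in> B2}"
    then consider X where "X \<in> B1" "Z = X \<times> J2" | X where "X \<in> B2" "Z = J1 \<times> X"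
      by blast
    then show "Z \<subseteq> J1 \<times> J2 \<and> simple_on J1 B1 (section1 J2 Z) \<and> section1 J2 Z \<in> J1 \<rightarrow> B2"
      by cases (use cyl1 cyl2 in \<open>simp_all only:\<close>)
  qed (rule section_Un section_empty section_Diff; assumption)+
  then show "simple_on J1 B1 (section1 J2 Z)" "section1 J2 Z \<in> J1 \<rightarrow> B2"
    by auto
qed

lemma simple_on_section2:
  assumes "algebra J1 B1" "algebra J2 B2" "Z \<in> product_algebra J1 B1 J2 B2"
  shows "simple_on J2 B2 (section2 J1 Z)" "section2 J1 Z \<in> J2 \<rightarrow> B1"
proof -
  interpret A1: algebra J1 B1 by fact
  interpret A2: algebra J2 B2 by fact
  have cyl1: "X \<times> J2 \<subseteq> J1 \<times> J2 \<and> simple_on J2 B2 (section2 J1 (X \<times> J2))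
      \<and> section2 J1 (X \<times> J2) \<in> J2 \<rightarrow> B1" if "X \<in> B1" for X
    using that A1.sets_into_space[OF that]
      simple_on_cong[OF simple_on_const[OF assms(2)], of X "section2 J1 (X \<times> J2)"]
    by (auto simp: section_cylinder)
  have cyl2: "J1 \<times> X \<subseteq> J1 \<times> J2 \<and> simple_on J2 B2 (section2 J1 (J1 \<times> X))
      \<and> section2 J1 (J1 \<times> X) \<in> J2 \<rightarrow> B1" if "X \<in> B2" for X
    using that A2.sets_into_space[OF that]
      simple_on_cong[OF simple_on_compose[OF assms(2) simple_on_mem[OF assms(2) that],
        of "\<lambda>c. if c then J1 else {}"], of "section2 J1 (J1 \<times> X)"]
    by (auto simp: section_cylinder)
  have "simple_on J2 B2 (section2 J1 Z) \<and> section2 J1 Z \<in> J2 \<rightarrow> B1"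
    \<comment> \<open>The algebras are swapped because sections are now indexed by \<open>J2\<close>
      and take values in \<open>B1\<close>; the ambient set stays
      \<open>J1 \<times> J2\<close>.\<close>
    using assms(2,1) assms(3)[unfolded product_algebra_def]
  proof (rule simple_on_section_hull)
    fix Z assume "Z \<in> {X1 \<times> J2 |X1. X1 \<in> B1} \<union> {J1 \<times> X2 |X2. X2 \<in> B2}"
    then consider X where "X \<in> B1" "Z = X \<times> J2" | X where "X \<in> B2" "Z = J1 \<times> X"
      by blast
    then show "Z \<subseteq> J1 \<times> J2 \<and> simple_on J2 B2 (section2 J1 Z) \<and> section2 J1 Z \<in> J2 \<rightarrow> B1"
      by cases (use cyl1 cyl2 in \<open>simp_all only:\<close>)
  qed (rule section_Un section_empty section_Diff; assumption)+
  then show "simple_on J2 B2 (section2 J1 Z)" "section2 J1 Z \<in> J2 \<rightarrow> B1"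
    by auto
qed

section \<open>The submodular coupling\<close>

theorem theorem3p18:
  fixes J1 :: "'a set" and B1 :: "'a set set"
    and J2 :: "'b set" and B2 :: "'b set set"
    and \<phi>1 \<alpha>1 :: "'a set \<Rightarrow> real"
    and \<phi>2 \<alpha>2 :: "'b set \<Rightarrow> real"
    and b :: "('a \<times> 'b) set \<Rightarrow> real"
  assumes "algebra J1 B1" and "algebra J2 B2"
    and "\<And>X. X \<in> B1 \<Longrightarrow> \<phi>1 X \<ge> 0" and "\<And>X. X \<in> B2 \<Longrightarrow> \<phi>2 X \<ge> 0"
    and "submodular_on B1 \<phi>1" and "submodular_on B2 \<phi>2"
    and "\<phi>1 {} = 0" and "\<phi>2 {} = 0"
    and "additive B1 \<alpha>1" and "additive B2 \<alpha>2"
    and "\<And>X. X \<in> B1 \<Longrightarrow> \<alpha>1 X \<ge> 0" and "\<And>X. X \<in> B2 \<Longrightarrow> \<alpha>2 X \<ge> 0"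
    and "\<alpha>1 J1 = \<phi>1 J1" and "\<alpha>2 J2 = \<phi>2 J2"
    and "\<And>Z. Z \<in> product_algebra J1 B1 J2 B2 \<Longrightarrow>
           b Z = charge_integral J1 \<alpha>1 (\<lambda>x. \<phi>2 (section1 J2 Z x))
               + charge_integral J2 \<alpha>2 (\<lambda>y. \<phi>1 (section2 J1 Z y))
               - charge_integral J1 \<alpha>1 (\<lambda>x. \<alpha>2 (section1 J2 Z x))"
  shows "submodular_on (product_algebra J1 B1 J2 B2) b \<and> coupling J1 B1 J2 B2 \<phi>1 \<phi>2 b"
proof
  interpret A1: algebra J1 B1 by fact
  interpret A2: algebra J2 B2 by fact
  note alg1 = assms(1) and alg2 = assms(2) and add1 = assms(9) and add2 = assms(10) and b = assms(15)
  show "submodular_on (product_algebra J1 B1 J2 B2) b"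
    unfolding submodular_on_def
  proof (intro ballI)
    fix Z W
    assume ZW: "Z \<in> product_algebra J1 B1 J2 B2" "W \<in> product_algebra J1 B1 J2 B2"
    note s1 = simple_on_section1[OF alg1 alg2 ZW(1)] simple_on_section1[OF alg1 alg2 ZW(2)]
    note s2 = simple_on_section2[OF alg1 alg2 ZW(1)] simple_on_section2[OF alg1 alg2 ZW(2)]
    \<comment> \<open>The two submodular inequalities are added and the modular equality is
      subtracted.\<close>
    show "b (Z \<inter> W) + b (Z \<union> W) \<le> b Z + b W"
      using charge_integral_submodular[OF alg1 alg2 add1 assms(11,4,6) s1]
        charge_integral_submodular[OF alg2 alg1 add2 assms(12,3,5) s2]
        charge_integral_modular[OF alg1 alg2 add1 add2 assms(12) s1]
      by (simp add: b ZW product_algebra_Int product_algebra_Un section_Int section_Un)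
  qed
  have "\<alpha>2 {} = 0"
    using add2 by (intro additive_empty) auto
  \<comment> \<open>The first and third integrals agree by \<open>\<alpha>2 J2 = \<phi>2 J2\<close>,
    which also turns the remaining \<open>\<phi>1 X * \<alpha>2 J2\<close> into the required
    product.\<close>
  have "b (X \<times> J2) = \<phi>1 X * \<phi>2 J2" if X: "X \<in> B1" for X
  proof -
    \<comment> \<open>Rewriting the product back into an integral leaves an equality of integrands
      on \<open>J1\<close>; off \<open>X\<close> the section is empty, where \<open>\<phi>2\<close>
      vanishes.\<close>
    have "charge_integral J1 \<alpha>1 (\<lambda>x. \<phi>2 (section1 J2 (X \<times> J2) x)) = \<phi>2 J2 * \<alpha>1 X"
      by (subst charge_integral_indicator[OF alg1 add1 X, symmetric])
        (auto simp: section_cylinder assms(4,8) intro!: charge_integral_cong)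
    moreover have "charge_integral J1 \<alpha>1 (\<lambda>x. \<alpha>2 (section1 J2 (X \<times> J2) x)) = \<alpha>2 J2 * \<alpha>1 X"
      by (subst charge_integral_indicator[OF alg1 add1 X, symmetric])
        (auto simp: section_cylinder assms(12) \<open>\<alpha>2 {} = 0\<close> intro!: charge_integral_cong)
    moreover have "charge_integral J2 \<alpha>2 (\<lambda>y. \<phi>1 (section2 J1 (X \<times> J2) y)) = \<phi>1 X * \<alpha>2 J2"
      using A1.sets_into_space[OF X]
      by (subst charge_integral_const[OF alg2 add2, symmetric])
        (auto simp: section_cylinder assms(3) X intro!: charge_integral_cong)
    ultimately show ?thesis
      by (simp add: b X product_algebra_cylinder1 assms(14))
  qed
  \<comment> \<open>Here \<open>\<alpha>1 J1 = \<phi>1 J1\<close> makes the second and third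
    integrals agree and turns the first into \<open>\<phi>1 J1 * \<phi>2 X\<close>.\<close>
  moreover have "b (J1 \<times> X) = \<phi>1 J1 * \<phi>2 X" if X: "X \<in> B2" for X
  proof -
    have "charge_integral J1 \<alpha>1 (\<lambda>x. \<phi>2 (section1 J2 (J1 \<times> X) x)) = \<phi>2 X * \<alpha>1 J1"
      using A2.sets_into_space[OF X]
      by (subst charge_integral_const[OF alg1 add1, symmetric])
        (auto simp: section_cylinder assms(4) X intro!: charge_integral_cong)
    moreover have "charge_integral J1 \<alpha>1 (\<lambda>x. \<alpha>2 (section1 J2 (J1 \<times> X) x)) = \<alpha>2 X * \<alpha>1 J1"
      using A2.sets_into_space[OF X]
      by (subst charge_integral_const[OF alg1 add1, symmetric])
        (auto simp: section_cylinder assms(12) X intro!: charge_integral_cong)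
    moreover have "charge_integral J2 \<alpha>2 (\<lambda>y. \<phi>1 (section2 J1 (J1 \<times> X) y)) = \<phi>1 J1 * \<alpha>2 X"
      by (subst charge_integral_indicator[OF alg2 add2 X, symmetric])
        (auto simp: section_cylinder assms(3,7) intro!: charge_integral_cong)
    ultimately show ?thesis
      by (simp add: b X product_algebra_cylinder2 assms(13))
  qed
  ultimately show "coupling J1 B1 J2 B2 \<phi>1 \<phi>2 b"
    by (simp add: coupling_def)
qed

end
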